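(* Let $q\ge2$ be an integer, let $(X,T)$ be a $\mathbb{Z}^q$-t.d.s. with metric $d$, let $K$ be a compact subset of $X$, and let $\vec{v}=(1,\beta_2,\ldots,\beta_q)\in\mathbb{R}^q$ be a direction vector. Then for any $\mathbf{b}\in\mathbb{R}^{q-1}_+$ the following statements are equivalent: (a) $K$ has bounded topological complexity with respect to $\{\hat{d}_k^{\vec{v},\mathbf{b}}\}_{k=1}^\infty$; (b) $K$ is $(\vec{v},\mathbf{b})$-equicontinuous in the mean.
   Context: A $\mathbb{Z}^q$-t.d.s. $(X,T)$ is a compact metric space $(X,d)$ with a group homomorphism $\vec{w}\mapsto T^{\vec{w}}$ from $\mathbb{Z}^q$ to the group of homeomorphisms of $X$. $\mathbb{R}^{q-1}_+$ is the set of vectors in $\mathbb{R}^{q-1}$ with all coordinates $>0$. For $\mathbf{b}=(b_2,\ldots,b_q)\in\mathbb{R}^{q-1}_+$ let $$\Lambda^{\vec{v}}(\mathbf{b})=\{(m_1,\ldots,m_q)\in\mathbb{Z}^q:\beta_im_1-b_i\le m_i\le\beta_im_1+b_i,\ i=2,\ldots,q\}$$ and, for $k\in\mathbb{N}=\{1,2,\dots\}$, $\Lambda_k^{\vec{v}}(\mathbf{b})=\Lambda^{\vec{v}}(\mathbf{b})\cap(\{0,1,\dots,k-1\}\times\mathbb{Z}^{q-1})$. For $x,y\in X$ define $$\hat{d}_k^{\vec{v},\mathbf{b}}(x,y)=\max_{1\le i\le k}\frac{1}{\#(\Lambda_i^{\vec{v}}(\mathbf{b}))}\sum_{\vec{w}\in\Lambda_i^{\vec{v}}(\mathbf{b})}d(T^{\vec{w}}x,T^{\vec{w}}y),$$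 and $B_{\hat{d}_k^{\vec{v},\mathbf{b}}}(x,\epsilon)=\{y\in X:\hat{d}_k^{\vec{v},\mathbf{b}}(x,y)<\epsilon\}$. A subset $K\subset X$ has bounded topological complexity with respect to $\{\hat{d}_k^{\vec{v},\mathbf{b}}\}$ if for every $\epsilon>0$ there is a positive integer $C=C(\epsilon)$ such that for every $k\in\mathbb{N}$ there is a finite $F\subset K$ with $\#(F)\le C$ and $K\subset\bigcup_{x\in F}B_{\hat{d}_k^{\vec{v},\mathbf{b}}}(x,\epsilon)$. A subset $K\subset X$ is $(\vec{v},\mathbf{b})$-equicontinuous in the mean if for every $\epsilon>0$ there is $\delta>0$ such that $\hat{d}_k^{\vec{v},\mathbf{b}}(x,y)<\epsilon$ for all $k\in\mathbb{N}$ and all $x,y\in K$ with $d(x,y)<\delta$. *)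

theory Defs
  imports "HOL-Analysis.Analysis"
begin

text \<open>
  Vectors with \<open>q\<close> coordinates are functions on the naturals, read at the indices \<open>1, \<dots>, q\<close>.
  Elements of the group \<open>\<int>\<^sup>q\<close> are required to vanish at all other indices, so that the
  representation is unique and sums and cardinalities over sets of them are the intended ones.
  Real vectors are only ever read at indices in \<open>{1..q}\<close>, so their other values are irrelevant.
\<close>

definition Zvec :: "nat \<Rightarrow> (nat \<Rightarrow> int) set" where
  "Zvec q = {m. \<forall>i. i \<notin> {1..q} \<longrightarrow> m i = 0}"

text \<open>
  The compact metric space is a compact subset \<open>X\<close> of a metric-space type, with metric \<open>dist\<close>
  and its subspace topology.  Preservation of the identity and of inverses follows from the
  last clause, since each \<open>T w\<close> is injective on \<open>X\<close>.
\<close>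

definition Zq_tds ::
    "nat \<Rightarrow> 'a::metric_space set \<Rightarrow> ((nat \<Rightarrow> int) \<Rightarrow> 'a \<Rightarrow> 'a) \<Rightarrow> bool" where
  "Zq_tds q X T \<longleftrightarrow>
     compact X \<and>
     (\<forall>w\<in>Zvec q. \<exists>S. homeomorphism X X (T w) S) \<and>
     (\<forall>u\<in>Zvec q. \<forall>w\<in>Zvec q. \<forall>x\<in>X. T (\<lambda>i. u i + w i) x = T u (T w x))"

text \<open>
  The direction vector is \<open>v\<close>; its coordinates \<open>v i\<close> for \<open>i \<ge> 2\<close> are the slopes \<open>\<beta>\<^sub>i\<close>, and
  \<open>v 1 = 1\<close>.
\<close>

definition Lambda :: "nat \<Rightarrow> (nat \<Rightarrow> real) \<Rightarrow> (nat \<Rightarrow> real) \<Rightarrow> (nat \<Rightarrow> int) set" where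
  "Lambda q v b =
     {m \<in> Zvec q. \<forall>i\<in>{2..q}. v i * real_of_int (m 1) - b i \<le> real_of_int (m i) \<and>
                             real_of_int (m i) \<le> v i * real_of_int (m 1) + b i}"

definition Lambda_upto ::
    "nat \<Rightarrow> (nat \<Rightarrow> real) \<Rightarrow> (nat \<Rightarrow> real) \<Rightarrow> nat \<Rightarrow> (nat \<Rightarrow> int) set" where
  "Lambda_upto q v b k = Lambda q v b \<inter> {m. m 1 \<in> {0..int k - 1}}"

lemma finite_Lambda_upto: "finite (Lambda_upto q v b k)"
proof -
  define B where "B = (\<Union>i\<in>{2..q}. \<Union>j\<in>{0..int k - 1}.
    {\<lceil>v i * real_of_int j - b i\<rceil>..\<lfloor>v i * real_of_int j + b i\<rfloor>}) \<union> {0..int k - 1}"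
  have "finite B" unfolding B_def by simp
  then have fin: "finite {m. \<forall>i. (i \<in> {1..q} \<longrightarrow> m i \<in> B) \<and> (i \<notin> {1..q} \<longrightarrow> m i = 0)}"
    by (intro finite_set_of_finite_funs) auto
  have "m i \<in> B" if m: "m \<in> Lambda_upto q v b k" and i: "i \<in> {1..q}" for m i
  proof (cases "i = 1")
    case True
    then show ?thesis using m by (auto simp: Lambda_upto_def B_def)
  next
    case False
    then have i2: "i \<in> {2..q}" using i by auto
    have "m 1 \<in> {0..int k - 1}"
      "m i \<in> {\<lceil>v i * real_of_int (m 1) - b i\<rceil>..\<lfloor>v i * real_of_int (m 1) + b i\<rfloor>}"
      using m i2 by (auto simp: Lambda_upto_def Lambda_def ceiling_le_iff le_floor_iff)
    then show ?thesis using i2 unfolding B_def by blast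
  qed
  moreover have "m i = 0" if "m \<in> Lambda_upto q v b k" "i \<notin> {1..q}" for m i
    using that by (auto simp: Lambda_upto_def Lambda_def Zvec_def)
  ultimately show ?thesis by (intro finite_subset[OF _ fin]) blast
qed

lemma Lambda_upto_nonempty:
  assumes "k \<ge> 1" "\<forall>i\<in>{2..q}. b i > 0"
  shows "Lambda_upto q v b k \<noteq> {}"
proof -
  have "(\<lambda>_. 0) \<in> Lambda_upto q v b k"
    using assms by (auto simp: Lambda_upto_def Lambda_def Zvec_def less_imp_le)
  then show ?thesis by blast
qed

definition dhat ::
    "nat \<Rightarrow> ((nat \<Rightarrow> int) \<Rightarrow> 'a \<Rightarrow> 'a) \<Rightarrow> (nat \<Rightarrow> real) \<Rightarrow> (nat \<Rightarrow> real) \<Rightarrow>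
     nat \<Rightarrow> 'a::metric_space \<Rightarrow> 'a \<Rightarrow> real" where
  "dhat q T v b k x y =
     Max ((\<lambda>i. (1 / real (card (Lambda_upto q v b i))) *
               (\<Sum>w\<in>Lambda_upto q v b i. dist (T w x) (T w y))) ` {1..k})"

definition dhat_ball ::
    "nat \<Rightarrow> 'a::metric_space set \<Rightarrow> ((nat \<Rightarrow> int) \<Rightarrow> 'a \<Rightarrow> 'a) \<Rightarrow> (nat \<Rightarrow> real) \<Rightarrow>
     (nat \<Rightarrow> real) \<Rightarrow> nat \<Rightarrow> 'a \<Rightarrow> real \<Rightarrow> 'a set" where
  "dhat_ball q X T v b k x \<epsilon> = {y \<in> X. dhat q T v b k x y < \<epsilon>}"

definition bounded_topological_complexity ::
    "nat \<Rightarrow> 'a::metric_space set \<Rightarrow> ((nat \<Rightarrow> int) \<Rightarrow> 'a \<Rightarrow> 'a) \<Rightarrow> (nat \<Rightarrow> real) \<Rightarrow>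
     (nat \<Rightarrow> real) \<Rightarrow> 'a set \<Rightarrow> bool" where
  "bounded_topological_complexity q X T v b K \<longleftrightarrow>
     (\<forall>\<epsilon>>0. \<exists>C::nat. C \<ge> 1 \<and>
        (\<forall>k\<ge>1. \<exists>F. finite F \<and> F \<subseteq> K \<and> card F \<le> C \<and>
                  K \<subseteq> (\<Union>x\<in>F. dhat_ball q X T v b k x \<epsilon>)))"

definition equicontinuous_in_the_mean ::
    "nat \<Rightarrow> ((nat \<Rightarrow> int) \<Rightarrow> 'a \<Rightarrow> 'a) \<Rightarrow> (nat \<Rightarrow> real) \<Rightarrow> (nat \<Rightarrow> real) \<Rightarrow>
     'a::metric_space set \<Rightarrow> bool" where
  "equicontinuous_in_the_mean q T v b K \<longleftrightarrow>
     (\<forall>\<epsilon>>0. \<exists>\<delta>>0. \<forall>k\<ge>1. \<forall>x\<in>K. \<forall>y\<in>K. dist x y < \<delta> \<longrightarrow> dhat q T v b k x y < \<epsilon>)"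

end

theory Submission
  imports Defs
begin

text \<open>
  By pigeonhole, bounded complexity bounds the size of a set that is separated for the supremum of
  the increasing sequence of pseudometrics. A separated set of maximal size then covers \<open>K\<close> by
  finitely many closed sets \<open>A s\<close>, each of small diameter for every pseudometric at once. Near a
  point \<open>z\<close> only the sets \<open>A s\<close> that contain \<open>z\<close> occur, so every point near \<open>z\<close> is uniformly close
  to \<open>z\<close>, and a Lebesgue number gives equicontinuity. The dynamics enter only through the
  continuity of each \<open>T w\<close>.
\<close>

text \<open>These are the properties of \<open>dhat\<close> on which compactness and pigeonhole act.
  Indices start at 1 because \<open>dhat\<close> at index 0 is a maximum over the empty set;
  symmetry survives even there.\<close>

locale increasing_pseudometrics =
  fixes K :: "'a::metric_space set" and D :: "nat \<Rightarrow> 'a \<Rightarrow> 'a \<Rightarrow> real"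
  assumes D_refl: "k \<ge> 1 \<Longrightarrow> D k x x = 0"
    and D_sym: "D k x y = D k y x"
    and D_triangle: "k \<ge> 1 \<Longrightarrow> D k x z \<le> D k x y + D k y z"
    and D_mono: "1 \<le> j \<Longrightarrow> j \<le> k \<Longrightarrow> D j x y \<le> D k x y"
    and closed_D_le: "k \<ge> 1 \<Longrightarrow> x \<in> K \<Longrightarrow> closed {y \<in> K. D k x y \<le> c}"
begin

text \<open>The index may depend on the pair: this is separation for the supremum over all
  \<open>k\<close>, phrased without forming that supremum.\<close>

definition separated :: "real \<Rightarrow> 'a set \<Rightarrow> bool" where
  "separated c S \<longleftrightarrow> finite S \<and> S \<subseteq> K \<and> (\<forall>x\<in>S. \<forall>y\<in>S. x \<noteq> y \<longrightarrow> (\<exists>k\<ge>1. c < D k x y))"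

text \<open>A finite set has finitely many pairs, and by \<open>D_mono\<close> a separation seen at
  one index persists at every larger one.\<close>

lemma separated_at_common_index:
  assumes "separated c S"
  obtains N where "N \<ge> 1" "\<And>x y. x \<in> S \<Longrightarrow> y \<in> S \<Longrightarrow> x \<noteq> y \<Longrightarrow> c < D N x y"
proof -
  have fin: "finite S" using assms by (simp add: separated_def)
  have "\<exists>k\<ge>1. x \<noteq> y \<longrightarrow> c < D k x y" if "x \<in> S" "y \<in> S" for x y
    using assms that unfolding separated_def by (metis order_refl)
  then obtain \<kappa> where \<kappa>: "\<And>x y. x \<in> S \<Longrightarrow> y \<in> S \<Longrightarrow> \<kappa> x y \<ge> 1"
    "\<And>x y. x \<in> S \<Longrightarrow> y \<in> S \<Longrightarrow> x \<noteq> y \<Longrightarrow> c < D (\<kappa> x y) x y"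
    by metis
  \<comment> \<open>Inserting 1 keeps the maximum defined, and at least 1, when \<open>S\<close> is
    empty.\<close>
  define N where "N = Max (insert 1 (case_prod \<kappa> ` (S \<times> S)))"
  have le_N: "\<kappa> x y \<le> N" if "x \<in> S" "y \<in> S" for x y
    unfolding N_def using fin that by (intro Max_ge) auto
  show ?thesis
  proof
    show "N \<ge> 1"
      unfolding N_def using fin by (intro Max_ge) auto
    show "c < D N x y" if "x \<in> S" "y \<in> S" "x \<noteq> y" for x y
      using less_le_trans[OF \<kappa>(2)[OF that] D_mono[OF \<kappa>(1) le_N]] that by simp
  qed
qed

text \<open>At the common index, two points of \<open>S\<close> assigned to the same centre would be
  less than \<open>2 * \<epsilon>\<close> apart. Since \<open>C\<close> is the same for every index,
  it bounds \<open>S\<close> whatever that index is.\<close>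

lemma card_separated_le:
  assumes cover: "\<And>k. k \<ge> 1 \<Longrightarrow> \<exists>F. finite F \<and> card F \<le> C \<and> (\<forall>y\<in>K. \<exists>x\<in>F. D k x y < \<epsilon>)"
    and S: "separated (2 * \<epsilon>) S"
  shows "card S \<le> C"
proof -
  obtain N where N: "N \<ge> 1" "\<And>x y. x \<in> S \<Longrightarrow> y \<in> S \<Longrightarrow> x \<noteq> y \<Longrightarrow> 2 * \<epsilon> < D N x y"
    using separated_at_common_index[OF S] by blast
  obtain F where F: "finite F" "card F \<le> C" "\<forall>y\<in>K. \<exists>x\<in>F. D N x y < \<epsilon>"
    using cover[OF N(1)] by blast
  have "\<forall>y\<in>S. \<exists>x. x \<in> F \<and> D N x y < \<epsilon>"
    using F(3) S by (auto simp: separated_def)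
  then obtain f where f: "\<And>y. y \<in> S \<Longrightarrow> f y \<in> F" "\<And>y. y \<in> S \<Longrightarrow> D N (f y) y < \<epsilon>"
    unfolding bchoice_iff by blast
  have "inj_on f S"
  proof (rule inj_onI, rule ccontr)
    fix x y assume xy: "x \<in> S" "y \<in> S" "f x = f y" "x \<noteq> y"
    have "D N x y \<le> D N (f x) x + D N (f y) y"
      using D_triangle[OF N(1), of x y "f x"] xy(3) by (simp add: D_sym)
    then show False
      using N(2)[of x y] f(2)[of x] f(2)[of y] xy by linarith
  qed
  then have "card S \<le> card F"
    using f(1) F(1) by (intro card_inj_on_le[of f]) auto
  with F(2) show ?thesis by simp
qed

text \<open>The cover may change with \<open>k\<close>, whereas here one centre \<open>s\<close>
  serves \<open>y\<close> at all indices. A point without such a centre could be added to a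
  separated set of maximal size.\<close>

lemma finite_uniform_net:
  assumes cover: "\<And>k. k \<ge> 1 \<Longrightarrow> \<exists>F. finite F \<and> card F \<le> C \<and> (\<forall>y\<in>K. \<exists>x\<in>F. D k x y < \<epsilon>)"
    and "\<epsilon> > 0"
  obtains S where "finite S" "S \<subseteq> K" "\<And>y. y \<in> K \<Longrightarrow> \<exists>s\<in>S. \<forall>k\<ge>1. D k s y \<le> 2 * \<epsilon>"
proof -
  have "separated (2 * \<epsilon>) {}" by (simp add: separated_def)
  moreover have "\<forall>S. separated (2 * \<epsilon>) S \<longrightarrow> card S < Suc C"
    using card_separated_le[OF cover] by (simp add: less_Suc_eq_le)
  ultimately obtain S where S: "separated (2 * \<epsilon>) S"
    and max: "\<And>S'. separated (2 * \<epsilon>) S' \<Longrightarrow> card S' \<le> card S"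
    using ex_has_greatest_nat[of "separated (2 * \<epsilon>)" "{}" card "Suc C"] by (metis less_imp_le)
  show ?thesis
  proof
    show "finite S" "S \<subseteq> K" using S by (auto simp: separated_def)
    show "\<exists>s\<in>S. \<forall>k\<ge>1. D k s y \<le> 2 * \<epsilon>" if "y \<in> K" for y
    proof (rule ccontr)
      assume "\<not> ?thesis"
      then have far: "\<forall>s\<in>S. \<exists>k\<ge>1. 2 * \<epsilon> < D k s y" by (auto simp: not_le)
      \<comment> \<open>\<open>separated\<close> ranges over ordered pairs, so the new point must be
        far from \<open>S\<close> in both orders.\<close>
      then have far': "\<forall>s\<in>S. \<exists>k\<ge>1. 2 * \<epsilon> < D k y s" by (simp only: D_sym[of _ y])
      \<comment> \<open>If \<open>y\<close> were in \<open>S\<close>, taking \<open>s = y\<close>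
        would give \<open>2 * \<epsilon> < 0\<close>. Hence inserting \<open>y\<close> really raises
        the cardinality.\<close>
      have "y \<notin> S" using far D_refl \<open>\<epsilon> > 0\<close> by fastforce
      moreover have "separated (2 * \<epsilon>) (insert y S)"
        using S far far' \<open>y \<in> K\<close> by (simp add: separated_def)
      ultimately show False
        using max[of "insert y S"] \<open>finite S\<close> by simp
    qed
  qed
qed

text \<open>The constant 8 counts radii: \<open>2 * \<epsilon>\<close> from a centre of the net to a
  point, doubled to compare a point with \<open>z\<close>, doubled again to compare two points near
  \<open>z\<close>.\<close>

lemma uniform_equicontinuity:
  assumes cover: "\<And>k. k \<ge> 1 \<Longrightarrow> \<exists>F. finite F \<and> card F \<le> C \<and> (\<forall>y\<in>K. \<exists>x\<in>F. D k x y < \<epsilon>)"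
    and "\<epsilon> > 0" and "compact K"
  obtains \<delta> where "\<delta> > 0"
    "\<And>k x y. k \<ge> 1 \<Longrightarrow> x \<in> K \<Longrightarrow> y \<in> K \<Longrightarrow> dist x y < \<delta> \<Longrightarrow> D k x y \<le> 8 * \<epsilon>"
proof -
  obtain S where S: "finite S" "S \<subseteq> K" "\<And>y. y \<in> K \<Longrightarrow> \<exists>s\<in>S. \<forall>k\<ge>1. D k s y \<le> 2 * \<epsilon>"
    using finite_uniform_net[OF cover \<open>\<epsilon> > 0\<close>] by blast
  define A where "A s = {y \<in> K. \<forall>k\<ge>1. D k s y \<le> 2 * \<epsilon>}" for s
  \<comment> \<open>Only finitely many closed sets are removed, none containing \<open>z\<close>, so
    \<open>U z\<close> is an open neighbourhood of each \<open>z\<close> in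
    \<open>K\<close>.\<close>
  define U where "U z = - (\<Union>s\<in>{s \<in> S. z \<notin> A s}. A s)" for z
  have "closed (A s)" if "s \<in> S" for s
  proof -
    have "A s = (\<Inter>k\<in>{1..}. {y \<in> K. D k s y \<le> 2 * \<epsilon>})"
      by (auto simp: A_def)
    also have "closed \<dots>"
      using S(2) that by (intro closed_INT ballI closed_D_le) auto
    finally show ?thesis .
  qed
  then have "open (U z)" for z
    unfolding U_def open_closed double_complement using S(1) by (intro closed_UN) auto
  then have "\<And>B. B \<in> U ` K \<Longrightarrow> open B" by auto
  moreover have "K \<subseteq> \<Union> (U ` K)" by (auto simp: U_def)
  ultimately obtain \<delta> where \<delta>: "\<delta> > 0" "\<And>x. x \<in> K \<Longrightarrow> \<exists>G\<in>U ` K. ball x \<delta> \<subseteq> G"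
    using Heine_Borel_lemma[OF \<open>compact K\<close>] by metis
  have near: "D k z y \<le> 4 * \<epsilon>" if y: "y \<in> U z" "y \<in> K" and "k \<ge> 1" for z y k
  proof -
    obtain s where s: "s \<in> S" "y \<in> A s"
      using S(3)[OF y(2)] y(2) by (auto simp: A_def)
    \<comment> \<open>Had \<open>A s\<close> missed \<open>z\<close>, it would have been removed
      from \<open>U z\<close>, yet it contains \<open>y\<close>.\<close>
    then have "z \<in> A s" using y(1) by (auto simp: U_def)
    then show ?thesis
      using s D_triangle[OF \<open>k \<ge> 1\<close>, of z y s] \<open>k \<ge> 1\<close> by (fastforce simp: A_def D_sym[of _ z s])
  qed
  show ?thesis
  proof
    show "\<delta> > 0" by fact
    show "D k x y \<le> 8 * \<epsilon>" if k: "k \<ge> 1" and xy: "x \<in> K" "y \<in> K" "dist x y < \<delta>" for k x y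
    proof -
      \<comment> \<open>The Lebesgue number puts \<open>x\<close> and \<open>y\<close> in a common
        \<open>U z\<close>, where \<open>z\<close> may differ from both.\<close>
      obtain z where "ball x \<delta> \<subseteq> U z" using \<delta>(2)[OF xy(1)] by blast
      then have "x \<in> U z" "y \<in> U z" using \<delta>(1) xy(3) by auto
      then show ?thesis
        using near[of x z k] near[of y z k] D_triangle[OF k, of x y z] k xy
        by (simp add: D_sym[of _ x z])
    qed
  qed
qed

end

text \<open>The average at a single scale \<open>i\<close>; bounds on \<open>dhat\<close> reduce to
  bounds on each of these.\<close>

definition orbit_mean ::
    "nat \<Rightarrow> ((nat \<Rightarrow> int) \<Rightarrow> 'a \<Rightarrow> 'a) \<Rightarrow> (nat \<Rightarrow> real) \<Rightarrow> (nat \<Rightarrow> real) \<Rightarrow>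
     nat \<Rightarrow> 'a::metric_space \<Rightarrow> 'a \<Rightarrow> real" where
  "orbit_mean q T v b i x y =
     (1 / real (card (Lambda_upto q v b i))) * (\<Sum>w\<in>Lambda_upto q v b i. dist (T w x) (T w y))"

lemma dhat_eq_Max_orbit_mean:
  "dhat q T v b k x y = Max ((\<lambda>i. orbit_mean q T v b i x y) ` {1..k})"
  by (simp add: dhat_def orbit_mean_def)

lemma orbit_mean_triangle:
  "orbit_mean q T v b i x z \<le> orbit_mean q T v b i x y + orbit_mean q T v b i y z"
  unfolding orbit_mean_def distrib_left[symmetric] sum.distrib[symmetric]
  by (intro mult_left_mono sum_mono dist_triangle) auto

lemma dhat_le_iff:
  "k \<ge> 1 \<Longrightarrow> dhat q T v b k x y \<le> c \<longleftrightarrow> (\<forall>i\<in>{1..k}. orbit_mean q T v b i x y \<le> c)"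
  by (simp add: dhat_eq_Max_orbit_mean)

lemma orbit_mean_le_dhat:
  "i \<in> {1..k} \<Longrightarrow> orbit_mean q T v b i x y \<le> dhat q T v b k x y"
  unfolding dhat_eq_Max_orbit_mean by (intro Max_ge) auto

text \<open>Each average is a finite sum of functions continuous on \<open>K\<close>, and bounding
  the maximum means intersecting finitely many sublevel sets. These are closed in the whole space
  because \<open>K\<close> is.\<close>

lemma closed_dhat_le:
  assumes "Zq_tds q X T" "K \<subseteq> X" "closed K" "k \<ge> 1"
  shows "closed {y \<in> K. dhat q T v b k x y \<le> c}"
proof -
  have "continuous_on K (T w)" if "w \<in> Lambda_upto q v b i" for w i
  proof -
    have "w \<in> Zvec q" using that by (simp add: Lambda_upto_def Lambda_def)
    then have "continuous_on X (T w)"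
      using assms(1) by (auto simp: Zq_tds_def homeomorphism_def)
    then show ?thesis using assms(2) by (rule continuous_on_subset)
  qed
  then have "continuous_on K (orbit_mean q T v b i x)" for i
    unfolding orbit_mean_def by (intro continuous_intros) auto
  then have "closed {y \<in> K. orbit_mean q T v b i x y \<le> c}" for i
    using \<open>closed K\<close> by (intro continuous_on_closed_Collect_le continuous_on_const) auto
  moreover have "{y \<in> K. dhat q T v b k x y \<le> c} =
      (\<Inter>i\<in>{1..k}. {y \<in> K. orbit_mean q T v b i x y \<le> c})"
    using \<open>k \<ge> 1\<close> by (auto simp: dhat_le_iff)
  ultimately show ?thesis by (auto)
qed

lemma increasing_pseudometrics_dhat:
  assumes "Zq_tds q X T" "K \<subseteq> X" "closed K"
  shows "increasing_pseudometrics K (dhat q T v b)"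
proof
  fix k j :: nat and x y z :: 'a and c :: real
  show "dhat q T v b k x y = dhat q T v b k y x"
    by (simp add: dhat_def dist_commute)
  show "dhat q T v b k x x = 0" if "k \<ge> 1"
    using that by (simp add: dhat_def)
  show "dhat q T v b k x z \<le> dhat q T v b k x y + dhat q T v b k y z" if "k \<ge> 1"
    unfolding dhat_le_iff[OF that]
    by (intro ballI order_trans[OF orbit_mean_triangle[of _ _ _ _ _ _ _ y]] add_mono orbit_mean_le_dhat)
  \<comment> \<open>The averages need not increase with the scale; their running maximum
    does.\<close>
  show "dhat q T v b j x y \<le> dhat q T v b k x y" if "1 \<le> j" "j \<le> k"
    using that by (auto simp: dhat_le_iff intro!: orbit_mean_le_dhat)
  show "closed {y \<in> K. dhat q T v b k x y \<le> c}" if "k \<ge> 1"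
    using closed_dhat_le[OF assms that] .
qed

theorem theoremA2:
  fixes q :: nat
    and X K :: "'a::metric_space set"
    and T :: "(nat \<Rightarrow> int) \<Rightarrow> 'a \<Rightarrow> 'a"
    and v b :: "nat \<Rightarrow> real"
  assumes "q \<ge> 2"
    and "Zq_tds q X T"
    and "K \<subseteq> X" and "compact K"
    and "v 1 = 1"
    and "\<forall>i\<in>{2..q}. b i > 0"
  shows "bounded_topological_complexity q X T v b K \<longleftrightarrow>
         equicontinuous_in_the_mean q T v b K"
proof
  interpret increasing_pseudometrics K "dhat q T v b"
    using increasing_pseudometrics_dhat[OF assms(2,3) compact_imp_closed[OF \<open>compact K\<close>]] .
  assume bounded: "bounded_topological_complexity q X T v b K"
  show "equicontinuous_in_the_mean q T v b K"
    unfolding equicontinuous_in_the_mean_def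
  proof (intro allI impI)
    fix \<epsilon> :: real assume "\<epsilon> > 0"
    \<comment> \<open>With 9 in place of 8, the bound \<open>8 * (\<epsilon> / 9)\<close> is
      strictly below \<open>\<epsilon>\<close>.\<close>
    then have "\<epsilon> / 9 > 0" by simp
    then obtain C where C: "\<forall>k\<ge>1. \<exists>F. finite F \<and> F \<subseteq> K \<and> card F \<le> C \<and>
        K \<subseteq> (\<Union>x\<in>F. dhat_ball q X T v b k x (\<epsilon> / 9))"
      using bounded[unfolded bounded_topological_complexity_def, rule_format, OF \<open>\<epsilon> / 9 > 0\<close>] by blast
    have "\<exists>F. finite F \<and> card F \<le> C \<and> (\<forall>y\<in>K. \<exists>x\<in>F. dhat q T v b k x y < \<epsilon> / 9)"
      if "k \<ge> 1" for k
      using C[rule_format, OF that] by (force simp: dhat_ball_def)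
    from uniform_equicontinuity[OF this \<open>\<epsilon> / 9 > 0\<close> \<open>compact K\<close>]
    obtain \<delta> where "\<delta> > 0" and \<delta>: "\<And>k x y. k \<ge> 1 \<Longrightarrow> x \<in> K \<Longrightarrow> y \<in> K \<Longrightarrow> dist x y < \<delta> \<Longrightarrow>
        dhat q T v b k x y \<le> 8 * (\<epsilon> / 9)"
      by blast
    have "dhat q T v b k x y < \<epsilon>" if "k \<ge> 1" "x \<in> K" "y \<in> K" "dist x y < \<delta>" for k x y
      using \<delta>[OF that] \<open>\<epsilon> > 0\<close> by linarith
    then show "\<exists>\<delta>>0. \<forall>k\<ge>1. \<forall>x\<in>K. \<forall>y\<in>K. dist x y < \<delta> \<longrightarrow> dhat q T v b k x y < \<epsilon>"
      using \<open>\<delta> > 0\<close> by (intro exI[of _ \<delta>]) simp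
  qed
next
  assume equi: "equicontinuous_in_the_mean q T v b K"
  show "bounded_topological_complexity q X T v b K"
    unfolding bounded_topological_complexity_def
  proof (intro allI impI)
    fix \<epsilon> :: real assume "\<epsilon> > 0"
    then obtain \<delta> where "\<delta> > 0" and \<delta>: "\<And>k x y. k \<ge> 1 \<Longrightarrow> x \<in> K \<Longrightarrow> y \<in> K \<Longrightarrow>
        dist x y < \<delta> \<Longrightarrow> dhat q T v b k x y < \<epsilon>"
      using equi[unfolded equicontinuous_in_the_mean_def, rule_format, OF \<open>\<epsilon> > 0\<close>] by metis
    have "K \<subseteq> (\<Union>x\<in>K. ball x \<delta>)" using \<open>\<delta> > 0\<close> by auto
    \<comment> \<open>The centres come from \<open>dist\<close> alone, before any \<open>k\<close>
      is chosen, so one \<open>F\<close> serves every \<open>k\<close>.\<close>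
    from compactE_image[OF \<open>compact K\<close> open_ball this]
    obtain F where F: "finite F" "F \<subseteq> K" "K \<subseteq> (\<Union>x\<in>F. ball x \<delta>)"
      by metis
    have "K \<subseteq> (\<Union>x\<in>F. dhat_ball q X T v b k x \<epsilon>)" if "k \<ge> 1" for k
    proof
      fix y assume "y \<in> K"
      then obtain x where "x \<in> F" "dist x y < \<delta>" using F(3) by auto
      then show "y \<in> (\<Union>x\<in>F. dhat_ball q X T v b k x \<epsilon>)"
        using \<delta>[OF that, of x y] F(2) \<open>y \<in> K\<close> \<open>K \<subseteq> X\<close> by (auto simp: dhat_ball_def)
    qed
    then show "\<exists>C::nat. C \<ge> 1 \<and> (\<forall>k\<ge>1. \<exists>F. finite F \<and> F \<subseteq> K \<and> card F \<le> C \<and>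
        K \<subseteq> (\<Union>x\<in>F. dhat_ball q X T v b k x \<epsilon>))"
      \<comment> \<open>The successor makes the bound positive even when \<open>F\<close> is
        empty.\<close>
      using F by (intro exI[of _ "Suc (card F)"] conjI allI impI exI[of _ F]) auto
  qed
qed

end
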